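(* Let $\mathbf{n}\in\mathbb{R}^3$ be a unit vector, let $\theta\in(-\pi,\pi)$, and let $\mathbf{Q}=\tan(\theta/2)\,\mathbf{n}$ be the Rodrigues' vector of the rotation of angle $\theta$ about the axis through the origin oriented by $\mathbf{n}$. Let $\mathbf{a}\in\mathbb{R}^3$ be a unit vector perpendicular to $\mathbf{n}$. Then the vector $$\frac{(\mathbf{1}+\mathbf{Q}\times)\mathbf{a}}{\|(\mathbf{1}+\mathbf{Q}\times)\mathbf{a}\|}$$ is the point of the rotation arc of $\mathbf{a}$ located at an angular distance from $\mathbf{a}$ equal to half the rotation angle; that is, $$\frac{\mathbf{a}+\mathbf{Q}\times\mathbf{a}}{\|\mathbf{a}+\mathbf{Q}\times\mathbf{a}\|}=\mathbf{R}(\mathbf{n},\theta/2)\,\mathbf{a}.$$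
   Context: For a unit vector $\mathbf{n}\in\mathbb{R}^3$ and $\varphi\in\mathbb{R}$, $\mathbf{R}(\mathbf{n},\varphi)$ denotes the (active, right-handed) rotation of $\mathbb{R}^3$ of angle $\varphi$ about the axis $\mathbb{R}\mathbf{n}$ through the origin, i.e. $\mathbf{R}(\mathbf{n},\varphi)\mathbf{x}=\cos\varphi\,\mathbf{x}+\sin\varphi\,(\mathbf{n}\times\mathbf{x})+(1-\cos\varphi)(\mathbf{n}\cdot\mathbf{x})\mathbf{n}$. The Rodrigues' vector of the rotation $\mathbf{R}(\mathbf{n},\theta)$, with $\theta\in(-\pi,\pi)$, is $\mathbf{Q}=\tan(\theta/2)\,\mathbf{n}$; $\mathbf{1}$ is the identity and $(\mathbf{Q}\times)$ is the linear operator $\mathbf{x}\mapsto\mathbf{Q}\times\mathbf{x}$. The rotation arc of $\mathbf{a}$ is $\{\mathbf{R}(\mathbf{n},\varphi)\mathbf{a}:\varphi\text{ between }0\text{ and }\theta\}$. $\|\cdot\|$ is the Euclidean norm. *)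

theory Defs
  imports "HOL-Analysis.Analysis" "HOL-Analysis.Cross3"
begin

unbundle cross3_syntax

definition rotation :: "real^3 \<Rightarrow> real \<Rightarrow> real^3 \<Rightarrow> real^3" where
  "rotation n \<phi> x =
     cos \<phi> *\<^sub>R x + sin \<phi> *\<^sub>R (n \<times> x) + ((1 - cos \<phi>) * (n \<bullet> x)) *\<^sub>R n"

definition rodrigues_vector :: "real^3 \<Rightarrow> real \<Rightarrow> real^3" where
  "rodrigues_vector n \<theta> = tan (\<theta> / 2) *\<^sub>R n"

(* The closed segment covers both signs of \<theta> and includes both end points. *)
definition rotation_arc :: "real^3 \<Rightarrow> real \<Rightarrow> real^3 \<Rightarrow> (real^3) set" where
  "rotation_arc n \<theta> a = (\<lambda>\<phi>. rotation n \<phi> a) ` closed_segment 0 \<theta>"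

(* The unsigned angle in [0, pi] between two nonzero vectors. *)
definition angular_distance :: "real^3 \<Rightarrow> real^3 \<Rightarrow> real" where
  "angular_distance x y = arccos ((x \<bullet> y) / (norm x * norm y))"

definition one_plus_cross :: "real^3 \<Rightarrow> real^3 \<Rightarrow> real^3" where
  "one_plus_cross Q = (\<lambda>x. x + Q \<times> x)"

end

(* For a perpendicular to n, the rotation carries a to cos phi a + sin phi (n x a), a combination of
   orthonormal vectors. Hence a + Q x a, with Q = tan (theta/2) n, is the positive multiple
   1 / cos (theta/2) of the rotation of a by theta/2, and the point of parameter phi on the arc lies at
   angular distance |phi| from a, which singles out phi = theta/2. *)
theory Submission
  imports Defs
begin

lemma rotation_perp:
  assumes "a \<bullet> n = 0"
  shows "rotation n \<phi> a = cos \<phi> *\<^sub>R a + sin \<phi> *\<^sub>R (n \<times> a)"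
  using assms by (simp add: rotation_def inner_commute)

text \<open>By Lagrange's identity \<open>a\<close> and \<open>n \<times> a\<close> have equal
  length; they are orthogonal, so Pythagoras applies.\<close>

lemma norm_rotation_perp:
  assumes "norm n = 1" "a \<bullet> n = 0"
  shows "norm (rotation n \<phi> a) = norm a"
proof -
  have "(norm (n \<times> a))\<^sup>2 = (norm a)\<^sup>2"
    using norm_cross[of n a] assms by (simp add: inner_commute)
  then have cross: "(n \<times> a) \<bullet> (n \<times> a) = a \<bullet> a"
    by (simp add: power2_norm_eq_inner)
  have "rotation n \<phi> a \<bullet> rotation n \<phi> a
      = (cos \<phi>)\<^sup>2 * (a \<bullet> a) + (sin \<phi>)\<^sup>2 * ((n \<times> a) \<bullet> (n \<times> a))"
    using assms
    by (simp add: rotation_perp inner_add_left inner_add_right dot_cross_self power2_eq_square)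
  also have "\<dots> = ((cos \<phi>)\<^sup>2 + (sin \<phi>)\<^sup>2) * (a \<bullet> a)"
    by (simp only: cross distrib_right)
  finally show ?thesis
    by (simp add: norm_eq_sqrt_inner)
qed

text \<open>The inner product of the two unit vectors is \<open>cos \<phi>\<close>. Since cosine is
  even, \<open>\<phi>\<close> can be replaced by its absolute value, which lies in the range where
  \<open>arccos\<close> inverts \<open>cos\<close>.\<close>

lemma angular_distance_rotation_perp:
  assumes "norm n = 1" "norm a = 1" "a \<bullet> n = 0" "\<bar>\<phi>\<bar> \<le> pi"
  shows "angular_distance a (rotation n \<phi> a) = \<bar>\<phi>\<bar>"
proof -
  have "a \<bullet> rotation n \<phi> a = cos \<phi>"
    using assms by (simp add: rotation_perp inner_add_right dot_cross_self norm_eq_1)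
  then have "angular_distance a (rotation n \<phi> a) = arccos (cos \<bar>\<phi>\<bar>)"
    using assms by (simp add: angular_distance_def norm_rotation_perp)
  with assms show ?thesis
    by (simp only: arccos_cos abs_ge_zero)
qed

text \<open>Multiplying by the cosine turns the tangent in Rodrigues' vector into
  \<open>sin (\<theta> / 2)\<close>.\<close>

lemma rotation_half_angle_eq:
  assumes "a \<bullet> n = 0" "cos (\<theta> / 2) \<noteq> 0"
  shows "rotation n (\<theta> / 2) a = cos (\<theta> / 2) *\<^sub>R one_plus_cross (rodrigues_vector n \<theta>) a"
  using assms
  by (simp add: rotation_perp one_plus_cross_def rodrigues_vector_def cross_mult_left
      scaleR_add_right tan_def)

theorem mainTheorem3:
  fixes n a Q :: "real^3" and \<theta> :: real
  assumes "norm n = 1"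
    and "- pi < \<theta>" and "\<theta> < pi"
    and "Q = rodrigues_vector n \<theta>"
    and "norm a = 1"
    and "a \<bullet> n = 0"
  shows "{p \<in> rotation_arc n \<theta> a. angular_distance a p = \<bar>\<theta>\<bar> / 2}
           = {one_plus_cross Q a /\<^sub>R norm (one_plus_cross Q a)}
         \<and> (a + Q \<times> a) /\<^sub>R norm (a + Q \<times> a) = rotation n (\<theta> / 2) a"
proof -
  let ?c = "cos (\<theta> / 2)" and ?v = "one_plus_cross Q a"
  have c: "?c > 0"
    using assms by (intro cos_gt_zero_pi) auto
  then have rot: "rotation n (\<theta> / 2) a = ?c *\<^sub>R ?v"
    using assms rotation_half_angle_eq by simp
  \<comment> \<open>Take norms in \<open>rot\<close>: the rotated vector is still a unit vector, and
    \<open>?c\<close> leaves the norm without absolute value because it is positive.\<close>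
  then have "?c * norm ?v = 1"
    using norm_rotation_perp[of n a "\<theta> / 2"] assms c by simp
  with c have "inverse (norm ?v) = ?c"
    by (metis inverse_unique mult.commute)
  then have normalized: "?v /\<^sub>R norm ?v = rotation n (\<theta> / 2) a"
    by (simp only: rot)
  have dist: "angular_distance a (rotation n \<phi> a) = \<bar>\<phi>\<bar>" if "\<phi> \<in> closed_segment 0 \<theta>" for \<phi>
    using that assms
    by (intro angular_distance_rotation_perp) (auto simp: closed_segment_eq_real_ivl split: if_splits)
  \<comment> \<open>Parameters on the segment never have the sign opposite to
    \<open>\<theta>\<close>, which excludes \<open>- \<theta> / 2\<close> unless
    \<open>\<theta> = 0\<close>.\<close>
  have half: "\<phi> \<in> closed_segment 0 \<theta> \<and> \<bar>\<phi>\<bar> = \<bar>\<theta>\<bar> / 2 \<longleftrightarrow> \<phi> = \<theta> / 2" for \<phi>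
    by (auto simp: closed_segment_eq_real_ivl abs_if split: if_splits)
  \<comment> \<open>By \<open>dist\<close> the condition on a point becomes one on any parameter
    producing it, so injectivity of the parametrization is not at issue.\<close>
  have "{p \<in> rotation_arc n \<theta> a. angular_distance a p = \<bar>\<theta>\<bar> / 2}
      = (\<lambda>\<phi>. rotation n \<phi> a) ` {\<phi>. \<phi> \<in> closed_segment 0 \<theta> \<and> \<bar>\<phi>\<bar> = \<bar>\<theta>\<bar> / 2}"
    by (auto simp: rotation_arc_def dist)
  also have "\<dots> = {?v /\<^sub>R norm ?v}"
    by (simp only: half normalized singleton_conv image_insert image_empty)
  finally show ?thesis
    using normalized by (simp add: one_plus_cross_def)
qed

end
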